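(* Let $\beta\ge 2$ be a fixed integer. There are constants $c_1,c_2>0$ depending only on $\beta$ such that in the $1:\beta$ PathWalker-Breaker game played on the complete graph $K_n$, under optimal play by both players, PathWalker visits all but $s$ vertices, where $c_1\log n\le s\le c_2\log n$.
   Context: The $1:\beta$ PathWalker-Breaker game on a graph $G$: two players, (Path)Walker and Breaker, alternate turns. Walker is positioned at a vertex of $G$ (her initial vertex counts as visited). On her turn she moves from her current vertex $v$ along an edge $e=vw$ of $G$ that has not been acquired by Breaker and such that $w$ has not previously been visited by her; she thereby acquires $e$ and visits $w$. On his turn Breaker acquires $\beta$ edges of $G$ not already acquired by either player. The game ends when there is no path from Walker's current position to an unvisited vertex using only edges not acquired by Breaker and (apart from the current position) only previously unvisited vertices. Walker wants to maximize, and Breaker to minimize, the number of vertices Walker visits. The paper states the hypothesis as $1<\beta=O(1)$, i.e. $\beta$ is a constant independent of $n$.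
   Formalization: The claim is proved for all n at least 3, with Walker moving first from any starting vertex; for n = 2 Walker visits both vertices, so s = 0 and the lower bound c_1 log n fails, and n = 1 is trivial. *)

theory Defs
  imports Complex_Main "HOL-Library.Ramsey"
begin

text \<open>
  A graph is given by a finite vertex set \<open>V\<close> and a set \<open>E\<close> of two-element subsets of \<open>V\<close>.
  A position of the game consists of Walker's current vertex \<open>v\<close>, the set \<open>U\<close> of visited
  vertices (with \<open>v \<in> U\<close>), the set \<open>W\<close> of Walker's edges and the set \<open>B\<close> of Breaker's edges.
\<close>

definition unvisited_path_from ::
  "'a set \<Rightarrow> 'a set set \<Rightarrow> 'a \<Rightarrow> 'a set \<Rightarrow> 'a set set \<Rightarrow> 'a list \<Rightarrow> bool" where
  "unvisited_path_from V E v U B p \<longleftrightarrow>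
     p \<noteq> [] \<and> distinct p \<and> set p \<subseteq> V - U \<and>
     successively (\<lambda>x y. {x, y} \<in> E - B) (v # p)"

definition game_over :: "'a set \<Rightarrow> 'a set set \<Rightarrow> 'a \<Rightarrow> 'a set \<Rightarrow> 'a set set \<Rightarrow> bool" where
  "game_over V E v U B \<longleftrightarrow> (\<nexists>p. unvisited_path_from V E v U B p)"

definition walker_moves :: "'a set \<Rightarrow> 'a set set \<Rightarrow> 'a \<Rightarrow> 'a set \<Rightarrow> 'a set set \<Rightarrow> 'a set" where
  "walker_moves V E v U B = {w \<in> V - U. {v, w} \<in> E - B}"

text \<open>
  Breaker acquires exactly \<open>\<beta>\<close> free edges, or all the free edges if fewer than \<open>\<beta>\<close> are left.
\<close>

definition breaker_moves ::
  "'a set set \<Rightarrow> nat \<Rightarrow> 'a set set \<Rightarrow> 'a set set \<Rightarrow> 'a set set set" where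
  "breaker_moves E \<beta> W B =
     {F. F \<subseteq> E - W - B \<and> card F = min \<beta> (card (E - W - B))}"

text \<open>
  The number of vertices finally visited under optimal play from a given position, by backward
  induction: \<open>walker_value\<close> when Walker is to move, \<open>breaker_value\<close> when Breaker is to move.
  The test \<open>infinite V\<close> only serves to make the recursion total.
\<close>

function walker_value ::
    "'a set \<Rightarrow> 'a set set \<Rightarrow> nat \<Rightarrow> 'a \<Rightarrow> 'a set \<Rightarrow> 'a set set \<Rightarrow> 'a set set \<Rightarrow> nat"
  and breaker_value ::
    "'a set \<Rightarrow> 'a set set \<Rightarrow> nat \<Rightarrow> 'a \<Rightarrow> 'a set \<Rightarrow> 'a set set \<Rightarrow> 'a set set \<Rightarrow> nat"
where
  "walker_value V E \<beta> v U W B =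
     (if infinite V \<or> game_over V E v U B then card U
      else MAX w\<in>walker_moves V E v U B.
             breaker_value V E \<beta> w (insert w U) (insert {v, w} W) B)"
| "breaker_value V E \<beta> v U W B =
     (if infinite V \<or> game_over V E v U B then card U
      else MIN F\<in>breaker_moves E \<beta> W B. walker_value V E \<beta> v U W (B \<union> F))"
  by pat_completeness auto
termination
proof (relation "measure (case_sum (\<lambda>(V, _, _, _, U, _). 2 * card (V - U))
                                   (\<lambda>(V, _, _, _, U, _). 2 * card (V - U) + 1))", goal_cases)
  case (2 V E \<beta> v U W B w)
  then have "w \<in> V - U" "finite V"
    by (auto simp: walker_moves_def)
  then have "card (V - insert w U) < card (V - U)"
    by (intro psubset_card_mono) auto
  then show ?case
    by simp
qed auto

declare walker_value.simps [simp del] breaker_value.simps [simp del]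

text \<open>The maximum and the minimum above range over nonempty sets, which are finite if \<open>E\<close> is.\<close>

lemma walker_moves_nonempty:
  assumes "\<not> game_over V E v U B"
  shows "walker_moves V E v U B \<noteq> {}"
proof -
  obtain p where "unvisited_path_from V E v U B p"
    using assms by (auto simp: game_over_def)
  then show ?thesis
    by (cases p) (auto simp: unvisited_path_from_def walker_moves_def)
qed

lemma breaker_moves_nonempty:
  "breaker_moves E \<beta> W B \<noteq> {}"
  using obtain_subset_with_card_n[of "min \<beta> (card (E - W - B))" "E - W - B"]
  by (auto simp: breaker_moves_def)

lemma finite_breaker_moves:
  "finite E \<Longrightarrow> finite (breaker_moves E \<beta> W B)"
  by (rule finite_subset[of _ "Pow E"]) (auto simp: breaker_moves_def)

text \<open>
  The number of vertices visited in the whole game, in which Walker starts at \<open>v\<close> and makes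
  the first move.
\<close>

definition pathwalker_value :: "'a set \<Rightarrow> 'a set set \<Rightarrow> nat \<Rightarrow> 'a \<Rightarrow> nat" where
  "pathwalker_value V E \<beta> v = walker_value V E \<beta> v {v} {} {}"

definition complete_graph_edges :: "nat \<Rightarrow> nat set set" where
  "complete_graph_edges n = [{..<n}]\<^bsup>2\<^esup>"

end

theory Submission
  imports Defs
begin

text \<open>
  Breaker isolates unvisited target vertices one after the other: with two edges per turn he keeps
  Walker's current vertex cut off from the target and joins the target to further unvisited
  vertices, so that a target is isolated by the time the number of unvisited vertices has halved.
  This saves about \<open>log\<^sub>2 n\<close> vertices.

  Walker keeps the average degree of Breaker's graph on the set \<open>R\<close> of unvisited vertices that she
  still cares about bounded, by moving to vertices of large degree whenever necessary. Vertices of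
  degree at least \<open>|R| / D\<close> are given up. While \<open>|R|\<close> halves, only \<open>O(|R|)\<close> edges of Breaker
  matter, hence only \<open>O(1)\<close> vertices are given up. The potential \<open>loss\<close>, a multiple of the average
  degree plus a multiple of \<open>ln |R|\<close>, turns this into an induction on \<open>|R|\<close>.
\<close>

section \<open>Optimal play\<close>

text \<open>The first vertex of any path to an unvisited vertex is itself a legal move, and
  conversely a legal move is a path with one vertex.\<close>

lemma game_over_iff: "game_over V E v U B \<longleftrightarrow> walker_moves V E v U B = {}"
proof
  show "walker_moves V E v U B = {}" if "game_over V E v U B"
  proof (rule ccontr)
    assume "walker_moves V E v U B \<noteq> {}"
    then obtain w where "w \<in> walker_moves V E v U B"
      by blast
    then have "unvisited_path_from V E v U B [w]"
      by (auto simp: unvisited_path_from_def walker_moves_def)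
    with that show False
      by (auto simp: game_over_def)
  qed
qed (metis walker_moves_nonempty)

lemma finite_walker_moves: "finite V \<Longrightarrow> finite (walker_moves V E v U B)"
  by (simp add: walker_moves_def)

lemma walker_value_game_over:
  "game_over V E v U B \<Longrightarrow> walker_value V E \<beta> v U W B = card U"
  by (simp add: walker_value.simps)

lemma walker_value_ge:
  assumes "finite V" "w \<in> walker_moves V E v U B"
  shows "breaker_value V E \<beta> w (insert w U) (insert {v, w} W) B \<le> walker_value V E \<beta> v U W B"
proof -
  have "\<not> game_over V E v U B"
    using assms(2) by (auto simp: game_over_iff)
  then show ?thesis
    using assms by (subst walker_value.simps) (auto intro!: Max_ge finite_walker_moves)
qed

lemma walker_value_attained:
  assumes "finite V" "\<not> game_over V E v U B"
  obtains w where "w \<in> walker_moves V E v U B"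
    "walker_value V E \<beta> v U W B = breaker_value V E \<beta> w (insert w U) (insert {v, w} W) B"
proof -
  let ?f = "\<lambda>w. breaker_value V E \<beta> w (insert w U) (insert {v, w} W) B"
  let ?M = "walker_moves V E v U B"
  have "Max (?f ` ?M) \<in> ?f ` ?M"
    using assms by (intro Max_in) (auto simp: finite_walker_moves game_over_iff)
  moreover have "walker_value V E \<beta> v U W B = Max (?f ` ?M)"
    using assms by (subst walker_value.simps) auto
  ultimately show ?thesis
    using that by auto
qed

lemma game_over_mono: "game_over V E v U B \<Longrightarrow> game_over V E v U (B \<union> F)"
  by (auto simp: game_over_iff walker_moves_def)

text \<open>Also covers a finished game: further Breaker edges leave it finished, so both values are
  \<open>card U\<close>.\<close>

lemma breaker_value_le:
  assumes "finite V" "finite E" "F \<in> breaker_moves E \<beta> W B"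
  shows "breaker_value V E \<beta> v U W B \<le> walker_value V E \<beta> v U W (B \<union> F)"
proof (cases "game_over V E v U B")
  case True
  then show ?thesis
    by (simp add: breaker_value.simps walker_value_game_over game_over_mono)
next
  case False
  then show ?thesis
    using assms by (subst breaker_value.simps) (auto intro!: Min_le finite_breaker_moves)
qed

lemma breaker_value_attained:
  assumes "finite V" "finite E"
  obtains F where "F \<in> breaker_moves E \<beta> W B"
    "breaker_value V E \<beta> v U W B = walker_value V E \<beta> v U W (B \<union> F)"
proof (cases "game_over V E v U B")
  case True
  then show ?thesis
    using that breaker_moves_nonempty[of E \<beta> W B]
    by (auto simp: breaker_value.simps walker_value_game_over game_over_mono)
next
  case False
  let ?f = "\<lambda>F. walker_value V E \<beta> v U W (B \<union> F)"
  let ?M = "breaker_moves E \<beta> W B"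
  have "Min (?f ` ?M) \<in> ?f ` ?M"
    using assms by (intro Min_in) (auto simp: finite_breaker_moves breaker_moves_nonempty)
  moreover have "breaker_value V E \<beta> v U W B = Min (?f ` ?M)"
    using assms False by (subst breaker_value.simps) auto
  ultimately show ?thesis
    using that by auto
qed

lemma walker_value_ge_card:
  assumes "finite V" "finite E"
  shows "card U \<le> walker_value V E \<beta> v U W B"
  using assms
proof (induction "card (V - U)" arbitrary: v U W B rule: less_induct)
  case less
  show ?case
  proof (cases "game_over V E v U B")
    case True
    then show ?thesis
      by (simp add: walker_value_game_over)
  next
    case False
    then obtain w where w: "w \<in> walker_moves V E v U B"
      "walker_value V E \<beta> v U W B = breaker_value V E \<beta> w (insert w U) (insert {v, w} W) B"
      using walker_value_attained less.prems(1) by metis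
    obtain F where F:
      "breaker_value V E \<beta> w (insert w U) (insert {v, w} W) B =
       walker_value V E \<beta> w (insert w U) (insert {v, w} W) (B \<union> F)"
      using breaker_value_attained[OF less.prems] by metis
    have "card (V - insert w U) < card (V - U)"
      using w(1) less.prems by (intro psubset_card_mono) (auto simp: walker_moves_def)
    then have "card (insert w U) \<le> walker_value V E \<beta> v U W B"
      unfolding w(2) F using less.hyps less.prems by blast
    then show ?thesis
      using card_insert_le[of U w] by linarith
  qed
qed

text \<open>A strategy then only has to name the edges \<open>F0\<close> it needs; the rest of
  Breaker's quota is filled arbitrarily.\<close>

lemma breaker_moves_extend:
  assumes "finite E" "F0 \<subseteq> E - W - B" "card F0 \<le> \<beta>"
  obtains F where "F \<in> breaker_moves E \<beta> W B" "F0 \<subseteq> F"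
proof -
  have "card F0 \<le> card (E - W - B)"
    using assms by (intro card_mono) auto
  then obtain F where "F0 \<subseteq> F" "F \<subseteq> E - W - B" "card F = min \<beta> (card (E - W - B))"
    using exists_subset_between[of F0 "min \<beta> (card (E - W - B))" "E - W - B"] assms by auto
  then show ?thesis
    using that by (auto simp: breaker_moves_def)
qed

lemma finite_pairs: "finite V \<Longrightarrow> finite ([V]\<^bsup>2\<^esup>)"
  by (simp add: finite_imp_finite_nsets)

section \<open>Breaker's strategy\<close>

text \<open>
  The set \<open>I\<close> consists of the isolated vertices and \<open>t\<close> is the current target. The number \<open>q\<close>
  bounds the rounds needed to isolate \<open>t\<close>; both \<open>q\<close> and the number of vertices in play drop by
  one in each round, so that their difference is invariant until \<open>t\<close> is isolated.
\<close>

lemma breaker_value_upper: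
  assumes "finite V" "\<beta> \<ge> 2" "U \<subseteq> V" "v \<in> U" "\<And>e. e \<in> W \<Longrightarrow> e \<subseteq> U"
    and "I \<subseteq> V - U" "t \<in> V - U - I" "A = V - U - I - {t}"
    and "\<And>x y. x \<in> I \<Longrightarrow> y \<in> insert v (insert t A) \<Longrightarrow> {x, y} \<in> B"
    and "card {y \<in> insert v A. {t, y} \<notin> B} \<le> 2 * q"
    and "j \<ge> 1" "j = 1 \<or> 2 ^ j + q \<le> card A + 2"
  shows "breaker_value V ([V]\<^bsup>2\<^esup>) \<beta> v U W B + card I + j \<le> card V"
  using assms(3-)
proof (induction "card (V - U) + j" arbitrary: v U W B I t A q j rule: less_induct)
  case less
  note prems = less.prems
  let ?E = "[V]\<^bsup>2\<^esup>"
  have fin: "finite V" "finite ?E" "finite U" "finite I" "finite A"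
    using assms(1) prems by (auto simp: finite_pairs finite_subset)
  have vA: "v \<notin> A" "t \<notin> A" "v \<noteq> t"
    using prems by auto
  have cV: "card V = card U + card I + card A + 1"
  proof -
    have "V = U \<union> (I \<union> (A \<union> {t}))"
      using prems by auto
    moreover have "card (U \<union> (I \<union> (A \<union> {t}))) = card U + (card I + (card A + 1))"
    proof -
      have "card (A \<union> {t}) = card A + 1"
        using fin vA by simp
      moreover have "card (I \<union> (A \<union> {t})) = card I + card (A \<union> {t})"
        using fin prems by (intro card_Un_disjoint) auto
      moreover have "card (U \<union> (I \<union> (A \<union> {t}))) = card U + card (I \<union> (A \<union> {t}))"
        using fin prems by (intro card_Un_disjoint) auto
      ultimately show ?thesis by simp
    qed
    ultimately show ?thesis by simp
  qed
  \<comment> \<open>Walker's half of a round, shared by the cases in which Breaker really moves. As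
    \<open>{t, v}\<close> is in \<open>B'\<close>, only the edges from \<open>t\<close> to
    \<open>A\<close> remain to be counted.\<close>
  have walker: "walker_value V ?E \<beta> v U W B' + card I + j \<le> card V"
    if B': "B \<subseteq> B'" "{t, v} \<in> B'" "card {y \<in> A. {t, y} \<notin> B'} \<le> 2 * q'"
      and j: "j = 1 \<or> 2 ^ j + q' \<le> card A + 1" for B' q'
  proof (cases "game_over V ?E v U B'")
    case True
    have "j \<le> card A + 1"
      using j less_exp[of j] by linarith
    then show ?thesis
      using True cV by (simp add: walker_value_game_over)
  next
    case False
    then obtain w where w: "w \<in> walker_moves V ?E v U B'"
      "walker_value V ?E \<beta> v U W B' = breaker_value V ?E \<beta> w (insert w U) (insert {v, w} W) B'"
      using walker_value_attained[OF fin(1)] by metis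
    then have w': "w \<in> V - U" "{v, w} \<notin> B'"
      by (auto simp: walker_moves_def)
    moreover have "{x, v} \<in> B'" if "x \<in> I" for x
      using prems(7)[of x v] that B' by auto
    \<comment> \<open>Walker cannot enter \<open>I\<close> or \<open>t\<close>: their edges to
      \<open>v\<close> belong to Breaker.\<close>
    ultimately have wA: "w \<in> A"
      using B'(2) prems(6) insert_commute[of v w "{}"] by auto
    have "card (V - insert w U) < card (V - U)"
      using w' fin by (intro psubset_card_mono) auto
    \<comment> \<open>Her new vertex takes over the role of \<open>v\<close>, so the set of vertices
      whose edges to \<open>t\<close> are counted is again \<open>A\<close>.\<close>
    moreover have "insert w (A - {w}) = A"
      using wA by auto
    moreover have "card (A - {w}) + 2 = card A + 1"
      using card_Suc_Diff1[OF fin(5) wA] by linarith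
    ultimately have "breaker_value V ?E \<beta> w (insert w U) (insert {v, w} W) B' + card I + j \<le> card V"
      using less.prems w' wA B' j
      by (intro less.hyps[where t = t and A = "A - {w}" and q = q']) (auto dest: prems(3))
    then show ?thesis
      using w by simp
  qed
  define N where "N = {y \<in> insert v A. {t, y} \<notin> B}"
  have finN: "finite N"
    using fin by (simp add: N_def)
  consider "q = 0" "j = 1" | "q = 0" "j \<ge> 2" | "q \<ge> 1"
    using prems(9) by linarith
  then show ?case
  proof cases
    case 1
    then have "N = {}"
      using prems(8) finN by (simp add: N_def)
    then have N: "{t, v} \<in> B" "{y \<in> A. {t, y} \<notin> B} = {}"
      by (auto simp: N_def)
    \<comment> \<open>The last target is already cut off from \<open>v\<close> and \<open>A\<close>,
      so any move of Breaker preserves this.\<close>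
    obtain F where F: "F \<in> breaker_moves ?E \<beta> W B"
      using breaker_moves_nonempty by blast
    have "walker_value V ?E \<beta> v U W (B \<union> F) + card I + j \<le> card V"
    proof (rule walker[where q' = 0])
      have "{y \<in> A. {t, y} \<notin> B \<union> F} = {}"
        using N by auto
      then show "card {y \<in> A. {t, y} \<notin> B \<union> F} \<le> 2 * 0"
        by (simp only: card.empty le0)
    qed (use N 1 in auto)
    then show ?thesis
      using breaker_value_le[OF fin(1,2) F, of v U] by linarith
  next
    case 2
    then have "N = {}"
      using prems(8) finN by (simp add: N_def)
    then have N: "{t, y} \<in> B" if "y \<in> insert v A" for y
      using that by (auto simp: N_def)
    have j: "2 ^ j \<le> card A + 2"
      using prems(10) 2 by simp
    have "(2::nat) ^ 2 \<le> 2 ^ j"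
      using 2 by (intro power_increasing) auto
    with j have "card A \<noteq> 0"
      by simp
    then obtain t' where t': "t' \<in> A"
      by (metis card.empty equals0I)
    have cA: "card (A - {t'}) = card A - 1"
      using t' fin by simp
    \<comment> \<open>No move is made here: \<open>t\<close> joins the isolated vertices and
      \<open>t'\<close> becomes the target. The induction measure still drops because
      \<open>j\<close> does.\<close>
    have "breaker_value V ?E \<beta> v U W B + card (insert t I) + (j - 1) \<le> card V"
    proof (rule less.hyps[where t = t' and A = "A - {t'}" and q = "(card A + 1) div 2"])
      have "card {y \<in> insert v (A - {t'}). {t', y} \<notin> B} \<le> card (insert v (A - {t'}))"
        using fin by (intro card_mono) auto
      also have "\<dots> = Suc (card (A - {t'}))"
        using fin vA by (intro card_insert_disjoint) auto
      also have "\<dots> = card A"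
        using fin t' by (intro card_Suc_Diff1)
      finally show "card {y \<in> insert v (A - {t'}). {t', y} \<notin> B} \<le> 2 * ((card A + 1) div 2)"
        by linarith
      \<comment> \<open>Halving \<open>2 ^ j \<le> card A + 2\<close> leaves exactly enough room for
        the new \<open>q\<close>, since
        \<open>(a + 2) div 2 + (a + 1) div 2 = a + 1\<close>.\<close>
      have "2 * 2 ^ (j - 1) = (2::nat) ^ j"
        using 2 by (simp flip: power_Suc)
      then show "j - 1 = 1 \<or> 2 ^ (j - 1) + (card A + 1) div 2 \<le> card (A - {t'}) + 2"
        using j cA \<open>card A \<noteq> 0\<close> by linarith
      show "{x, y} \<in> B" if "x \<in> insert t I" "y \<in> insert v (insert t' (A - {t'}))" for x y
        using that N[of y] prems(7)[of x y] t' by auto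
    qed (use prems t' vA 2 in auto)
    moreover have "card (insert t I) = card I + 1"
      using prems fin by simp
    ultimately show ?thesis
      using 2 by simp
  next
    case 3
    \<comment> \<open>Two missing edges at \<open>t\<close> are taken per turn. The one to
      \<open>v\<close> has priority, as Walker could otherwise step onto the target.\<close>
    obtain N0 where N0: "N0 \<subseteq> N" "card N0 \<le> 2" "v \<in> N \<Longrightarrow> v \<in> N0" "card (N - N0) \<le> 2 * (q - 1)"
    proof (cases "card N \<le> 2")
      case True
      then show ?thesis
        using that[of N] by simp
    next
      case False
      define S where "S = N \<inter> {v}"
      have "card S \<le> card {v}"
        unfolding S_def by (intro card_mono) auto
      then obtain N0 where "S \<subseteq> N0" "N0 \<subseteq> N" "card N0 = 2"
        using exists_subset_between[of S 2 N] False finN by (auto simp: S_def)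
      moreover from this have "card (N - N0) = card N - 2"
        using finN by (simp add: card_Diff_subset finite_subset)
      moreover have "card N \<le> 2 * q"
        using prems(8) by (simp only: N_def)
      moreover have "v \<in> N \<Longrightarrow> v \<in> N0"
        using \<open>S \<subseteq> N0\<close> by (auto simp: S_def)
      ultimately show ?thesis
        using that[of N0] by linarith
    qed
    define F0 where "F0 = (\<lambda>y. {t, y}) ` N0"
    have tn: "t \<in> V" "t \<notin> U" "t \<notin> N"
      using prems vA by (auto simp: N_def)
    have NV: "N \<subseteq> V"
      using prems by (auto simp: N_def)
    have "F0 \<subseteq> ?E - W - B"
    proof
      fix f assume "f \<in> F0"
      then obtain y where y: "y \<in> N" "f = {t, y}"
        using N0 by (auto simp: F0_def)
      then have "f \<in> ?E"
        using tn NV by auto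
      \<comment> \<open>Walker's edges join visited vertices, so no edge at the unvisited
        \<open>t\<close> is hers.\<close>
      moreover have "f \<notin> W"
        using prems(3)[of f] y tn by auto
      ultimately show "f \<in> ?E - W - B"
        using y by (auto simp: N_def)
    qed
    moreover have "card F0 \<le> \<beta>"
    proof -
      have "card F0 \<le> card N0"
        unfolding F0_def using finN N0 by (intro card_image_le) (auto intro: finite_subset)
      then show ?thesis
        using N0 assms(2) by linarith
    qed
    ultimately obtain F where F: "F \<in> breaker_moves ?E \<beta> W B" "F0 \<subseteq> F"
      using breaker_moves_extend[OF fin(2)] by metis
    have "walker_value V ?E \<beta> v U W (B \<union> F) + card I + j \<le> card V"
    proof (rule walker[where q' = "q - 1"])
      show "{t, v} \<in> B \<union> F"
        using N0(3) F(2) by (auto simp: N_def F0_def)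
      have "{y \<in> A. {t, y} \<notin> B \<union> F} \<subseteq> N - N0"
        using F(2) by (auto simp: N_def F0_def)
      then have "card {y \<in> A. {t, y} \<notin> B \<union> F} \<le> card (N - N0)"
        using finN by (intro card_mono) auto
      then show "card {y \<in> A. {t, y} \<notin> B \<union> F} \<le> 2 * (q - 1)"
        using N0 by linarith
    qed (use prems(10) 3 in auto)
    then show ?thesis
      using breaker_value_le[OF fin(1,2) F(1), of v U] by linarith
  qed
qed

lemma pathwalker_value_upper:
  assumes "finite V" "\<beta> \<ge> 2" "v \<in> V" "card V \<ge> 3"
    and "j \<ge> 1" "j = 1 \<or> 2 ^ j \<le> card V div 2"
  shows "pathwalker_value V ([V]\<^bsup>2\<^esup>) \<beta> v + j \<le> card V"
proof (cases "game_over V ([V]\<^bsup>2\<^esup>) v {v} {}")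
  case True
  have "j < card V"
    using assms less_exp[of j] by linarith
  then show ?thesis
    using True by (simp add: pathwalker_value_def walker_value_game_over)
next
  case False
  then obtain w where w: "w \<in> walker_moves V ([V]\<^bsup>2\<^esup>) v {v} {}"
    "pathwalker_value V ([V]\<^bsup>2\<^esup>) \<beta> v = breaker_value V ([V]\<^bsup>2\<^esup>) \<beta> w {w, v} {{v, w}} {}"
    unfolding pathwalker_value_def by (metis walker_value_attained[OF assms(1)])
  then have w': "w \<in> V" "w \<noteq> v"
    by (auto simp: walker_moves_def)
  then have c: "card (V - {w, v}) = card V - 2"
    using assms by (subst card_Diff_subset) auto
  then have "V - {w, v} \<noteq> {}"
    using assms(4) by fastforce
  then obtain t where t: "t \<in> V - {w, v}"
    by blast
  define A where "A = V - {w, v} - {} - {t}"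
  have cA: "card A = card V - 3"
    unfolding A_def using c t assms by simp
  have "breaker_value V ([V]\<^bsup>2\<^esup>) \<beta> w {w, v} {{v, w}} {} + card ({} :: 'a set) + j \<le> card V"
  proof (rule breaker_value_upper[OF assms(1,2) _ _ _ _ _ A_def])
    have "card {y \<in> insert w A. {t, y} \<notin> {}} \<le> card (insert w A)"
      using assms(1) by (intro card_mono) (auto simp: A_def)
    also have "\<dots> \<le> card A + 1"
      using assms(1) by (simp add: A_def card_insert_if)
    finally have "card {y \<in> insert w A. {t, y} \<notin> {}} \<le> card A + 1" .
    then show "card {y \<in> insert w A. {t, y} \<notin> {}} \<le> 2 * ((card A + 2) div 2)"
      by linarith
    \<comment> \<open>The source of \<open>card V div 2\<close>: with
      \<open>card A + 2 = card V - 1\<close>, subtracting its half rounded down leaves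
      \<open>card V div 2\<close>.\<close>
    show "j = 1 \<or> 2 ^ j + (card A + 2) div 2 \<le> card A + 2"
      using assms(4,6) cA by linarith
  qed (use w' t assms in auto)
  then show ?thesis
    using w by simp
qed

section \<open>Degrees in Breaker's graph\<close>

definition nbrs :: "'a set set \<Rightarrow> 'a \<Rightarrow> 'a set \<Rightarrow> 'a set" where
  "nbrs B x R = {y \<in> R. y \<noteq> x \<and> {x, y} \<in> B}"

abbreviation deg :: "'a set set \<Rightarrow> 'a \<Rightarrow> 'a set \<Rightarrow> nat" where
  "deg B x R \<equiv> card (nbrs B x R)"

text \<open>Twice the number of Breaker's edges inside \<open>R\<close>; divided by
  \<open>card R\<close> it is the average degree.\<close>

definition degsum :: "'a set set \<Rightarrow> 'a set \<Rightarrow> nat" where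
  "degsum B R = (\<Sum>x\<in>R. deg B x R)"

lemma finite_nbrs: "finite R \<Longrightarrow> finite (nbrs B x R)"
  by (simp add: nbrs_def)

lemma deg_mono: "finite R \<Longrightarrow> S \<subseteq> R \<Longrightarrow> deg B x S \<le> deg B x R"
  by (intro card_mono finite_nbrs) (auto simp: nbrs_def)

lemma deg_Un: "deg (B \<union> F) x R \<le> deg B x R + deg F x R"
proof -
  have "nbrs (B \<union> F) x R = nbrs B x R \<union> nbrs F x R"
    by (auto simp: nbrs_def)
  then show ?thesis
    by (simp add: card_Un_le)
qed

lemma deg_le_card_edges: "finite F \<Longrightarrow> deg F x R \<le> card F"
  by (rule card_inj_on_le[where f = "\<lambda>y. {x, y}"])
     (auto simp: nbrs_def inj_on_def doubleton_eq_iff)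

lemma deg_Un_le: "finite F \<Longrightarrow> deg (B \<union> F) x R \<le> deg B x R + card F"
  using deg_Un[of B F x R] deg_le_card_edges[of F x R] by linarith

lemma card_orientations_le: "card ({(x, y). {x, y} = f} \<inter> S) \<le> 2"
proof (cases "\<exists>a b. f = {a, b}")
  case True
  then obtain a b where "f = {a, b}"
    by blast
  then have "{(x, y). {x, y} = f} \<inter> S \<subseteq> {(a, b), (b, a)}"
    by (simp add: doubleton_eq_iff subset_iff)
  then have "card ({(x, y). {x, y} = f} \<inter> S) \<le> card {(a, b), (b, a)}"
    by (intro card_mono) simp_all
  also have "\<dots> \<le> 2"
    by (intro card_insert_le_m1) simp_all
  finally show ?thesis .
next
  case False
  then have "{(x, y). {x, y} = f} = {}"
    by (simp add: set_eq_iff[of _ "{}"] eq_commute)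
  then show ?thesis
    by (simp only: card.empty Int_empty_left)
qed

text \<open>Double counting: an edge contributes at most its two orientations.\<close>

lemma degsum_edges_le:
  assumes "finite R" "finite F"
  shows "degsum F R \<le> 2 * card F"
proof -
  have "degsum F R = card (SIGMA x:R. nbrs F x R)"
    using assms by (simp add: degsum_def finite_nbrs)
  also have "\<dots> \<le> card (\<Union>f\<in>F. {(x, y). {x, y} = f} \<inter> R \<times> R)"
    using assms by (intro card_mono) (auto simp: nbrs_def)
  also have "\<dots> \<le> (\<Sum>f\<in>F. card ({(x, y). {x, y} = f} \<inter> R \<times> R))"
    by (rule card_UN_le[OF assms(2)])
  also have "\<dots> \<le> (\<Sum>f\<in>F. 2)"
    by (intro sum_mono card_orientations_le)
  finally show ?thesis
    by simp
qed

lemma degsum_Un: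
  assumes "finite R" "finite F"
  shows "degsum (B \<union> F) R \<le> degsum B R + 2 * card F"
proof -
  have "degsum (B \<union> F) R \<le> (\<Sum>x\<in>R. deg B x R + deg F x R)"
    unfolding degsum_def by (intro sum_mono deg_Un)
  also have "\<dots> = degsum B R + degsum F R"
    by (simp add: degsum_def sum.distrib)
  finally show ?thesis
    using degsum_edges_le[OF assms] by linarith
qed

text \<open>Deleting \<open>x\<close> removes its own term and lowers the degree of each of its
  neighbours by one.\<close>

lemma degsum_remove:
  assumes "finite R" "x \<in> R"
  shows "degsum B R = degsum B (R - {x}) + 2 * deg B x R"
proof -
  let ?S = "R - {x}"
  have "deg B y R = deg B y ?S + (if y \<in> nbrs B x R then 1 else 0)" if "y \<in> ?S" for y
  proof -
    have "nbrs B y R = (if y \<in> nbrs B x R then insert x (nbrs B y ?S) else nbrs B y ?S)"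
      using that assms insert_commute[of x y "{}"] by (auto simp: nbrs_def)
    moreover have "x \<notin> nbrs B y ?S" "finite (nbrs B y ?S)"
      using assms by (auto simp: nbrs_def)
    ultimately show ?thesis
      by simp
  qed
  then have "(\<Sum>y\<in>?S. deg B y R) = degsum B ?S + (\<Sum>y\<in>?S. if y \<in> nbrs B x R then 1 else 0)"
    by (simp add: degsum_def sum.distrib)
  also have "(\<Sum>y\<in>?S. if y \<in> nbrs B x R then 1 else 0) = card (?S \<inter> nbrs B x R)"
    using assms by (simp add: sum.If_cases Int_def)
  also have "?S \<inter> nbrs B x R = nbrs B x R"
    by (auto simp: nbrs_def)
  finally show ?thesis
    using assms by (simp add: degsum_def sum.remove)
qed

text \<open>Markov's inequality for degrees.\<close>

lemma card_high_degree:
  assumes "finite R"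
  shows "card {x \<in> R. c < deg B x R} * Suc c \<le> degsum B R"
proof -
  have "card {x \<in> R. c < deg B x R} * Suc c \<le> (\<Sum>x\<in>{x \<in> R. c < deg B x R}. deg B x R)"
    using sum_bounded_below[of "{x \<in> R. c < deg B x R}" "Suc c" "\<lambda>x. deg B x R"] by simp
  also have "\<dots> \<le> degsum B R"
    unfolding degsum_def using assms by (intro sum_mono2) auto
  finally show ?thesis .
qed

section \<open>Walker's strategy\<close>

text \<open>Bounds how many vertices of \<open>R\<close> remain unvisited, for
  \<open>r = card R\<close> and \<open>m = degsum B R\<close>. The average degree pays for vertices
  given up, the logarithm for the growth of that average, and the constant for the endgame
  \<open>r \<le> 2 * K * D\<close>.\<close>

definition loss :: "nat \<Rightarrow> nat \<Rightarrow> nat \<Rightarrow> nat \<Rightarrow> nat \<Rightarrow> real" where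
  "loss \<beta> K D r m =
     real D * (real m / real r) + 4 * real D * (real \<beta> + real K) * ln (real r) + 2 * real K * real D"

lemma loss_lower: "2 * real K * real D \<le> loss \<beta> K D r m"
proof (cases "r = 0")
  case False
  then have "ln (real r) \<ge> 0"
    by simp
  then show ?thesis
    by (simp add: loss_def)
\<comment> \<open>For \<open>r = 0\<close> the default values \<open>m / 0 = 0\<close> and
  \<open>ln 0 = 0\<close> leave the constant term.\<close>
qed (simp add: loss_def)

text \<open>The inequality \<open>ln x \<le> x - 1\<close> at
  \<open>x = (r - 1) / r\<close>.\<close>

lemma inverse_le_ln_diff:
  assumes "r \<ge> 2"
  shows "1 / real r \<le> ln (real r) - ln (real (r - 1))"
proof -
  have "ln (real (r - 1) / real r) \<le> real (r - 1) / real r - 1"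
    using assms by (intro ln_le_minus_one) auto
  also have "\<dots> = - 1 / real r"
    using assms by (simp add: field_simps of_nat_diff)
  finally show ?thesis
    using assms by (simp add: ln_div)
qed

text \<open>Giving up a vertex of degree \<open>d \<ge> r / D\<close> lowers \<open>D * m\<close> by
  at least \<open>2 * r\<close>. Half of this pays for the lost vertex; the other half offsets the
  smaller denominator, because \<open>D * m \<le> r * r\<close>.\<close>

lemma loss_give_up:
  assumes "r \<ge> 2" "m' + 2 * d \<le> m" "r \<le> D * d" "m \<le> 2 * K * r" "2 * K * D \<le> r"
  shows "loss \<beta> K D (r - 1) m' + 1 \<le> loss \<beta> K D r m"
proof -
  have "D * (m' + 2 * d) \<le> D * m"
    using assms(2) by (intro mult_left_mono) auto
  then have "D * m' + 2 * r \<le> D * m"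
    using assms(3) by (simp add: algebra_simps)
  then have 1: "real D * real m' + 2 * real r \<le> real D * real m"
    by (simp flip: of_nat_mult of_nat_add)
  have "D * m \<le> D * (2 * K * r)"
    using assms(4) by (intro mult_left_mono) auto
  also have "\<dots> \<le> r * r"
    using mult_right_mono[OF assms(5), of r] by (simp add: algebra_simps)
  finally have 2: "real D * real m \<le> real r * real r"
    by (simp flip: of_nat_mult)
  have "(real D * real m' + (real r - 1)) * real r \<le> (real D * real m - real r - 1) * real r"
    using 1 by (intro mult_right_mono) auto
  also have "\<dots> \<le> real D * real m * (real r - 1)"
    using 2 assms(1) by (simp add: algebra_simps)
  finally have "real D * real m' / (real r - 1) + 1 \<le> real D * real m / real r"
    using assms(1) by (simp add: divide_simps)
  moreover have "ln (real (r - 1)) \<le> ln (real r)"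
    using assms(1) by simp
  then have "4 * real D * (real \<beta> + real K) * ln (real (r - 1))
      \<le> 4 * real D * (real \<beta> + real K) * ln (real r)"
    by (intro mult_left_mono) auto
  ultimately show ?thesis
    using assms(1) by (simp add: loss_def of_nat_diff)
qed

text \<open>In an ordinary round Breaker adds at most \<open>2 * \<beta>\<close> to \<open>m\<close>
  and \<open>r\<close> drops by one, so the average rises by at most
  \<open>4 * (\<beta> + K) / r\<close>. The decrease of the logarithmic term covers this, which
  fixes its coefficient.\<close>

lemma loss_one_step:
  assumes "r \<ge> 2" "m' \<le> m + 2 * \<beta>" "m \<le> 2 * K * r"
  shows "loss \<beta> K D (r - 1) m' \<le> loss \<beta> K D r m"
proof -
  have r: "real r \<ge> 2"
    using assms(1) by simp
  have m: "real m' \<le> real m + 2 * real \<beta>"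
    using of_nat_mono[OF assms(2), where 'a = real] by simp
  have "real m \<le> 2 * real K * real r"
    using of_nat_mono[OF assms(3), where 'a = real] by simp
  then have mr: "real m / real r \<le> 2 * real K"
    using r by (simp add: field_simps)
  have "real m' / (real r - 1) \<le> (real m + 2 * real \<beta>) / (real r - 1)"
    using m r by (intro divide_right_mono) auto
  also have "\<dots> = real m / real r + (2 * real \<beta> + real m / real r) / (real r - 1)"
    using r by (simp add: field_simps)
  also have "\<dots> \<le> real m / real r + (2 * real \<beta> + 2 * real K) / (real r - 1)"
    using mr r by (intro add_left_mono divide_right_mono) auto
  also have "(2 * real \<beta> + 2 * real K) / (real r - 1) \<le> (2 * real \<beta> + 2 * real K) / (real r / 2)"
    using r by (intro divide_left_mono) auto
  also have "\<dots> = 4 * (real \<beta> + real K) * (1 / real r)"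
    by simp
  also have "\<dots> \<le> 4 * (real \<beta> + real K) * (ln (real r) - ln (real (r - 1)))"
    using inverse_le_ln_diff[OF assms(1)] by (intro mult_left_mono) auto
  finally have "real D * (real m' / (real r - 1)) \<le>
     real D * (real m / real r + 4 * (real \<beta> + real K) * (ln (real r) - ln (real (r - 1))))"
    by (intro mult_left_mono) auto
  then show ?thesis
    using assms(1) by (simp add: loss_def of_nat_diff algebra_simps)
qed

text \<open>Removing two vertices together with \<open>4 * K\<close>, at least twice the average,
  from the degree sum cannot raise the average.\<close>

lemma loss_two_steps:
  assumes "r \<ge> 3" "m' + 4 * K \<le> m" "m \<le> 2 * K * r"
  shows "loss \<beta> K D (r - 2) m' \<le> loss \<beta> K D r m"
proof -
  have r: "real r \<ge> 3"
    using assms(1) by simp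
  have m: "real m' + 4 * real K \<le> real m"
    using of_nat_mono[OF assms(2), where 'a = real] by simp
  have m2: "real m \<le> 2 * real K * real r"
    using of_nat_mono[OF assms(3), where 'a = real] by simp
  have "real m' * real r \<le> (real m - 4 * real K) * real r"
    using m by (intro mult_right_mono) auto
  also have "\<dots> \<le> real m * (real r - 2)"
    using m2 by (simp add: algebra_simps)
  finally have "real m' / (real r - 2) \<le> real m / real r"
    using r by (simp add: divide_simps)
  then have "real D * (real m' / (real r - 2)) \<le> real D * (real m / real r)"
    by (intro mult_left_mono) auto
  moreover have "4 * real D * (real \<beta> + real K) * ln (real (r - 2))
      \<le> 4 * real D * (real \<beta> + real K) * ln (real r)"
    using assms(1) by (intro mult_left_mono) auto
  ultimately show ?thesis
    using assms(1) by (simp add: loss_def of_nat_diff)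
qed

section \<open>Rounds of play and the induction on \<open>card R\<close>\<close>

text \<open>A full round: Walker's move to \<open>w\<close> followed by an optimal reply
  \<open>F\<close>.\<close>

lemma walker_step:
  assumes "finite V" "U \<subseteq> V" "v \<in> U" "w \<in> V - U" "{v, w} \<notin> B"
  obtains F where "finite F" "card F \<le> \<beta>"
    "walker_value V ([V]\<^bsup>2\<^esup>) \<beta> w (insert w U) (insert {v, w} W) (B \<union> F)
       \<le> walker_value V ([V]\<^bsup>2\<^esup>) \<beta> v U W B"
proof -
  have "w \<in> walker_moves V ([V]\<^bsup>2\<^esup>) v U B"
    using assms by (auto simp: walker_moves_def)
  note * = walker_value_ge[OF assms(1) this, of \<beta> W]
  obtain F where F: "F \<in> breaker_moves ([V]\<^bsup>2\<^esup>) \<beta> (insert {v, w} W) B"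
    "breaker_value V ([V]\<^bsup>2\<^esup>) \<beta> w (insert w U) (insert {v, w} W) B =
     walker_value V ([V]\<^bsup>2\<^esup>) \<beta> w (insert w U) (insert {v, w} W) (B \<union> F)"
    using breaker_value_attained[OF assms(1) finite_pairs[OF assms(1)]] by metis
  have "finite F"
    using F(1) finite_subset[OF _ finite_pairs[OF assms(1)], of F] by (auto simp: breaker_moves_def)
  then show ?thesis
    using that[of F] F * by (auto simp: breaker_moves_def)
qed

text \<open>The invariants are an average degree of at most \<open>2 * K\<close> on \<open>R\<close>
  and at most \<open>D\<close> blocked edges from \<open>v\<close> into \<open>R\<close>. The first
  leaves few vertices of large degree, the second leaves Walker almost all of \<open>R\<close> to
  choose from.\<close>

lemma walker_value_lower:
  assumes "finite V" and K: "K = \<beta> + 2" and D: "D = 8 * K + \<beta>"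
    and "U \<subseteq> V" "v \<in> U" "R \<subseteq> V - U"
    and "degsum B R \<le> 2 * K * card R" "deg B v R \<le> D"
  shows "real (card U) + real (card R) \<le>
    real (walker_value V ([V]\<^bsup>2\<^esup>) \<beta> v U W B) + loss \<beta> K D (card R) (degsum B R)"
  using assms(4-)
proof (induction "card R" arbitrary: v U W B R rule: less_induct)
  case less
  note prems = less.prems
  let ?val = "walker_value V ([V]\<^bsup>2\<^esup>) \<beta>"
  define r m where "r = card R" and "m = degsum B R"
  have D_pos: "0 < D"
    using K D by simp
  have finR: "finite R"
    using assms(1) prems by (auto intro: finite_subset)
  have finU: "finite U"
    using assms(1) prems by (auto intro: finite_subset)
  have m: "m \<le> 2 * K * r"
    using prems by (simp add: m_def r_def)
  consider "r \<le> 2 * K * D" | x where "2 * K * D < r" "x \<in> R" "r \<le> D * deg B x R"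
    | "2 * K * D < r" "\<And>x. x \<in> R \<Longrightarrow> D * deg B x R < r"
    by (meson not_le)
  then show ?case
  proof cases
    case 1
    have "card U \<le> ?val v U W B"
      using assms(1) by (intro walker_value_ge_card finite_pairs)
    moreover have "real (card R) \<le> 2 * real K * real D"
      using of_nat_mono[OF 1, where 'a = real] by (simp add: r_def)
    ultimately show ?thesis
      using loss_lower[of K D \<beta> "card R" "degsum B R"] by linarith
  next
    case 2
    \<comment> \<open>Give up \<open>x\<close> without moving: only \<open>R\<close> shrinks. The
      degree of \<open>x\<close> is at least \<open>K\<close>, so the average stays below
      \<open>2 * K\<close>.\<close>
    have cR: "card (R - {x}) = r - 1"
      using 2 finR by (simp add: r_def)
    have sum: "m = degsum B (R - {x}) + 2 * deg B x R"
      unfolding m_def by (rule degsum_remove[OF finR 2(2)])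
    have r2: "r \<ge> 2"
      using 2 K D by simp
    have "D * K \<le> D * deg B x R"
      using 2 mult.commute[of K D] by linarith
    then have "K \<le> deg B x R"
      using D_pos by (simp only: mult_le_cancel1)
    then have "degsum B (R - {x}) \<le> 2 * K * (r - 1)"
      using sum m r2 by (simp add: diff_mult_distrib2)
    moreover have "deg B v (R - {x}) \<le> D"
      using prems(5) deg_mono[OF finR, of "R - {x}" B v] by auto
    ultimately have "real (card U) + real (card (R - {x})) \<le>
        real (?val v U W B) + loss \<beta> K D (card (R - {x})) (degsum B (R - {x}))"
      using prems cR r2 by (intro less.hyps) (auto simp: r_def)
    moreover have "loss \<beta> K D (r - 1) (degsum B (R - {x})) + 1 \<le> loss \<beta> K D r m"
      using 2 m sum r2 by (intro loss_give_up[where d = "deg B x R"]) auto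
    ultimately show ?thesis
      using cR r2 by (simp add: r_def m_def of_nat_diff)
  next
    case 3
    have "2 * K * 16 \<le> 2 * K * D"
      using K D by (intro mult_left_mono) auto
    then have r_large: "2 * K * 16 < r"
      using 3(1) by linarith
    define N where "N = R - nbrs B v R"
    have N: "w \<in> R" "w \<in> V - U" "{v, w} \<notin> B" if "w \<in> N" for w
      using that prems by (auto simp: N_def nbrs_def)
    show ?thesis
    proof (cases "\<exists>w\<in>N. 2 * K + 2 * \<beta> \<le> deg B w R")
      case True
      \<comment> \<open>Visiting \<open>w1\<close> lowers the degree sum by \<open>4 * K\<close>
        even after two replies of Breaker. Its degree may exceed \<open>D\<close>, so the invariant
        is restored only after a second move, to a vertex \<open>w2\<close> of small degree.\<close>
      then obtain w1 where w1: "w1 \<in> N" "2 * K + 2 * \<beta> \<le> deg B w1 R"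
        by blast
      define U1 R1 where "U1 = insert w1 U" and "R1 = R - {w1}"
      obtain F1 where F1: "finite F1" "card F1 \<le> \<beta>"
        "?val w1 U1 (insert {v, w1} W) (B \<union> F1) \<le> ?val v U W B"
        using walker_step[OF assms(1) prems(1,2) N(2,3)[OF w1(1)]] unfolding U1_def by metis
      define B1 m1 where "B1 = B \<union> F1" and "m1 = degsum B1 R1"
      have cR1: "card R1 = r - 1" "finite R1"
        using N(1)[OF w1(1)] finR by (auto simp: r_def R1_def)
      have m1: "m1 + 4 * K + 2 * \<beta> \<le> m"
        using degsum_remove[OF finR N(1)[OF w1(1)], of B] degsum_Un[OF cR1(2) F1(1), of B] F1(2) w1(2)
        unfolding m_def m1_def B1_def R1_def by linarith
      \<comment> \<open>Degrees above four times the average bound \<open>2 * K\<close> occur at no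
        more than a quarter of the vertices. Outside \<open>X\<close>, one reply of Breaker keeps
        the degree within \<open>D = 8 * K + \<beta>\<close>.\<close>
      define X where "X = {x \<in> R1. 8 * K < deg B1 x R1}"
      have "card X * Suc (8 * K) \<le> 2 * K * r"
        using card_high_degree[OF cR1(2), of "8 * K" B1] m1 m unfolding X_def m1_def by linarith
      moreover have "card X * Suc (8 * K) = 2 * K * (4 * card X) + card X"
        by simp
      ultimately have "2 * K * (4 * card X) \<le> 2 * K * r"
        by linarith
      moreover have "0 < 2 * K"
        using K by simp
      ultimately have X: "4 * card X \<le> r"
        by (simp only: mult_le_cancel1)
      \<comment> \<open>As \<open>D \<ge> 16\<close>, the neighbours of \<open>w1\<close> before the
        reply number less than \<open>r / 16\<close>, so \<open>X\<close> and the blocked vertices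
        cannot fill \<open>R1\<close>.\<close>
      have "16 * deg B w1 R \<le> D * deg B w1 R"
        using K D by (intro mult_right_mono) auto
      then have "16 * deg B w1 R < r"
        using 3(2)[OF N(1)[OF w1(1)]] by linarith
      moreover have "deg B1 w1 R1 \<le> deg B w1 R + \<beta>"
        using deg_Un_le[OF F1(1), of B w1 R1] F1(2) deg_mono[OF finR, of R1 B w1]
        unfolding B1_def R1_def by auto
      ultimately have "card X + deg B1 w1 R1 < card R1"
        using X r_large cR1 K by linarith
      moreover have "card (X \<union> nbrs B1 w1 R1) \<le> card X + deg B1 w1 R1"
        by (rule card_Un_le)
      moreover have "card R1 \<le> card (X \<union> nbrs B1 w1 R1)" if "R1 \<subseteq> X \<union> nbrs B1 w1 R1"
        using that cR1(2) by (intro card_mono) (auto simp: X_def finite_nbrs)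
      ultimately obtain w2 where w2: "w2 \<in> R1" "w2 \<notin> X" "w2 \<notin> nbrs B1 w1 R1"
        by fastforce
      have w2': "w2 \<in> V - U1" "{w1, w2} \<notin> B1" "w1 \<in> U1" "U1 \<subseteq> V"
        using w2 prems N[OF w1(1)] by (auto simp: R1_def U1_def nbrs_def)
      define U2 R2 where "U2 = insert w2 U1" and "R2 = R1 - {w2}"
      define W2 where "W2 = insert {w1, w2} (insert {v, w1} W)"
      obtain F2 where F2: "finite F2" "card F2 \<le> \<beta>"
        "?val w2 U2 W2 (B1 \<union> F2) \<le> ?val w1 U1 (insert {v, w1} W) B1"
        using walker_step[OF assms(1) w2'(4,3,1,2)] unfolding U2_def W2_def by metis
      define B2 m2 where "B2 = B1 \<union> F2" and "m2 = degsum B2 R2"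
      have cR2: "card R2 = r - 2" "finite R2"
        using w2(1) cR1 by (auto simp: R2_def)
      have m2: "m2 + 4 * K \<le> m"
        using degsum_remove[OF cR1(2) w2(1), of B1] degsum_Un[OF cR2(2) F2(1), of B1] F2(2) m1
        unfolding m1_def m2_def B2_def R2_def by linarith
      have "deg B2 w2 R2 \<le> D"
        using deg_Un_le[OF F2(1), of B1 w2 R2] F2(2) deg_mono[OF cR1(2), of R2 B1 w2] w2 D
        unfolding B2_def R2_def X_def by auto
      moreover have "degsum B2 R2 \<le> 2 * K * card R2"
        using m2 m cR2(1) by (simp add: m2_def diff_mult_distrib2)
      ultimately have "real (card U2) + real (card R2) \<le>
          real (?val w2 U2 W2 B2) + loss \<beta> K D (card R2) (degsum B2 R2)"
        using prems cR2 r_large w2' N[OF w1(1)]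
        by (intro less.hyps) (auto simp: U2_def U1_def R2_def R1_def r_def)
      moreover have "card U2 = card U + 2"
        using finU N(2)[OF w1(1)] w2'(1) by (simp add: U2_def U1_def)
      moreover have "loss \<beta> K D (r - 2) m2 \<le> loss \<beta> K D r m"
        using m m2 r_large K by (intro loss_two_steps) auto
      ultimately show ?thesis
        using F1(3) F2(3) cR2 r_large by (simp add: r_def m_def m2_def B1_def B2_def of_nat_diff)
    next
      case False
      \<comment> \<open>The inequality says that the average bound survives the visit to
        \<open>w\<close> and Breaker's reply.\<close>
      obtain w where w: "w \<in> N" "m + 2 * \<beta> \<le> 2 * K * (r - 1) + 2 * deg B w R"
      proof (cases "\<exists>w\<in>N. K + \<beta> \<le> deg B w R")
        case True
        then obtain w where "w \<in> N" "K + \<beta> \<le> deg B w R"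
          by blast
        moreover from this have "m + 2 * \<beta> \<le> 2 * K * (r - 1) + 2 * deg B w R"
          using m by (simp add: diff_mult_distrib2)
        ultimately show ?thesis
          using that by blast
      next
        case low: False
        \<comment> \<open>The at most \<open>D\<close> blocked vertices have degree below
          \<open>r / D\<close> each, hence contribute at most \<open>r\<close> altogether.\<close>
        have "D * (\<Sum>x\<in>nbrs B v R. deg B x R) = (\<Sum>x\<in>nbrs B v R. D * deg B x R)"
          by (simp add: sum_distrib_left)
        also have "\<dots> \<le> (\<Sum>x\<in>nbrs B v R. r)"
          using 3(2) by (intro sum_mono less_imp_le) (auto simp: nbrs_def)
        also have "\<dots> \<le> D * r"
          using prems(5) by simp
        finally have "(\<Sum>x\<in>nbrs B v R. deg B x R) \<le> r"
          using D_pos by (simp only: mult_le_cancel1)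
        moreover have "(\<Sum>x\<in>N. deg B x R) \<le> (\<Sum>x\<in>N. K + \<beta>)"
          using low by (intro sum_mono) auto
        moreover have "(\<Sum>x\<in>N. K + \<beta>) \<le> r * (K + \<beta>)"
        proof -
          have "card N \<le> r"
            unfolding r_def N_def using finR by (intro card_mono) auto
          then show ?thesis
            by simp
        qed
        moreover have "m = (\<Sum>x\<in>N. deg B x R) + (\<Sum>x\<in>nbrs B v R. deg B x R)"
          unfolding m_def degsum_def N_def using finR
          by (intro sum.subset_diff) (auto simp: nbrs_def)
        ultimately have "m \<le> r * (K + \<beta>) + r"
          by linarith
        \<comment> \<open>This determines \<open>K = \<beta> + 2\<close>: then
          \<open>K + \<beta> + 1 = 2 * K - 1\<close>, which leaves a slack of \<open>r\<close> for
          one more round.\<close>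
        then have "m + r \<le> 2 * K * r"
          using K by (simp add: algebra_simps)
        then have small: "m + 2 * \<beta> \<le> 2 * K * (r - 1)"
          using r_large K by (simp add: diff_mult_distrib2)
        have "nbrs B v R \<noteq> R"
        proof
          assume "nbrs B v R = R"
          then have "r \<le> D"
            using prems(5) by (simp add: r_def)
          moreover have "1 * D \<le> 2 * K * D"
            using K by (intro mult_right_mono) auto
          ultimately show False
            using 3(1) by linarith
        qed
        then obtain w where "w \<in> N"
          by (auto simp: N_def nbrs_def)
        then show ?thesis
          using that[of w] small by linarith
      qed
      define U1 R1 W1 where "U1 = insert w U" and "R1 = R - {w}" and "W1 = insert {v, w} W"
      obtain F where F: "finite F" "card F \<le> \<beta>" "?val w U1 W1 (B \<union> F) \<le> ?val v U W B"
        using walker_step[OF assms(1) prems(1,2) N(2,3)[OF w(1)]] unfolding U1_def W1_def by metis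
      define B1 m1 where "B1 = B \<union> F" and "m1 = degsum B1 R1"
      have cR1: "card R1 = r - 1" "finite R1"
        using N(1)[OF w(1)] finR by (auto simp: r_def R1_def)
      have m1: "m1 + 2 * deg B w R \<le> m + 2 * \<beta>"
        using degsum_remove[OF finR N(1)[OF w(1)], of B] degsum_Un[OF cR1(2) F(1), of B] F(2)
        unfolding m_def m1_def B1_def R1_def by linarith
      have "deg B w R < 2 * K + 2 * \<beta>"
        using False w(1) by (meson not_le)
      moreover have "deg B1 w R1 \<le> deg B w R + \<beta>"
        using deg_Un_le[OF F(1), of B w R1] F(2) deg_mono[OF finR, of R1 B w]
        unfolding B1_def R1_def by auto
      ultimately have "deg B1 w R1 \<le> D"
        using K D by linarith
      moreover have "degsum B1 R1 \<le> 2 * K * card R1"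
        using m1 w(2) cR1(1) by (simp add: m1_def)
      ultimately have "real (card U1) + real (card R1) \<le>
          real (?val w U1 W1 B1) + loss \<beta> K D (card R1) (degsum B1 R1)"
        using prems cR1 r_large N[OF w(1)]
        by (intro less.hyps) (auto simp: U1_def R1_def r_def)
      moreover have "card U1 = card U + 1"
        using finU N(2)[OF w(1)] by (simp add: U1_def)
      moreover have "loss \<beta> K D (r - 1) m1 \<le> loss \<beta> K D r m"
        using m m1 r_large K by (intro loss_one_step) auto
      ultimately show ?thesis
        using F(3) cR1 r_large by (simp add: r_def m_def m1_def B1_def of_nat_diff)
    qed
  qed
qed

section \<open>Both bounds combined for the complete graph\<close>

theorem theorem2:
  fixes \<beta> :: nat
  assumes "\<beta> \<ge> 2"
  shows "\<exists>c1 c2 :: real. c1 > 0 \<and> c2 > 0 \<and>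
    (\<forall>n::nat \<ge> 3. \<forall>v<n. \<exists>s::nat.
       pathwalker_value {..<n} (complete_graph_edges n) \<beta> v + s = n \<and>
       c1 * ln (real n) \<le> real s \<and> real s \<le> c2 * ln (real n))"
proof -
  define K D where "K = \<beta> + 2" and "D = 8 * K + \<beta>"
  define c2 where "c2 = 4 * real D * (real \<beta> + real K) + 2 * real K * real D"
  have "\<exists>s. pathwalker_value {..<n} (complete_graph_edges n) \<beta> v + s = n \<and>
      1 / 3 * ln (real n) \<le> real s \<and> real s \<le> c2 * ln (real n)"
    if n: "n \<ge> 3" and v: "v < n" for n v
  proof -
    let ?p = "pathwalker_value {..<n} (complete_graph_edges n) \<beta> v"
    obtain k where k: "2 ^ k \<le> n div 2" "n div 2 < 2 ^ (k + 1)"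
      using ex_power_ivl1[of 2 "n div 2"] n by force
    \<comment> \<open>The maximum with 1 handles \<open>n = 3\<close>, where
      \<open>k = 0\<close>.\<close>
    have j: "?p + max 1 k \<le> n"
      using pathwalker_value_upper[of "{..<n}" \<beta> v "max 1 k"] n v assms k
      by (auto simp: complete_graph_edges_def max_def)
    define s where "s = n - ?p"
    have "n \<le> 2 ^ (k + 2)"
      using k by simp
    then have "real n \<le> 2 ^ (k + 2)"
      by (metis of_nat_le_iff of_nat_numeral of_nat_power)
    then have "ln (real n) \<le> ln (2 ^ (k + 2))"
      using n by (subst ln_le_cancel_iff) auto
    also have "\<dots> = real (k + 2) * ln 2"
      by (simp only: ln_realpow)
    also have "\<dots> \<le> real (k + 2) * 1"
      using ln_2_less_1 by (intro mult_left_mono) auto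
    \<comment> \<open>From \<open>s \<ge> max 1 k\<close>; this is the origin of
      \<open>c1 = 1 / 3\<close>.\<close>
    also have "k + 2 \<le> 3 * s"
      using j unfolding s_def by linarith
    finally have lower: "1 / 3 * ln (real n) \<le> real s"
      by simp
    let ?R = "{..<n} - {v}"
    have d: "degsum {} ?R = 0" "deg {} v ?R = 0"
      by (simp_all add: degsum_def nbrs_def)
    have cR: "card ?R = n - 1"
      using v by simp
    have "real (card {v}) + real (card ?R) \<le> real ?p + loss \<beta> K D (card ?R) (degsum {} ?R)"
      unfolding pathwalker_value_def complete_graph_edges_def
      using v d by (intro walker_value_lower[OF _ K_def D_def]) auto
    then have "real n \<le> real ?p + 4 * real D * (real \<beta> + real K) * ln (real (n - 1)) + 2 * real K * real D"
      using n d cR by (simp add: loss_def of_nat_diff)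
    moreover have "4 * real D * (real \<beta> + real K) * ln (real (n - 1))
        \<le> 4 * real D * (real \<beta> + real K) * ln (real n)"
      using n by (intro mult_left_mono) auto
    \<comment> \<open>The additive constant is absorbed into the logarithm, since
      \<open>exp 1 \<le> 3 \<le> n\<close>.\<close>
    moreover have "2 * real K * real D * 1 \<le> 2 * real K * real D * ln (real n)"
    proof (intro mult_left_mono)
      have "exp 1 \<le> real n"
        using exp_le n by linarith
      then show "1 \<le> ln (real n)"
        using n by (subst ln_ge_iff) auto
    qed auto
    ultimately have "real n - real ?p \<le> c2 * ln (real n)"
      by (simp add: c2_def algebra_simps)
    then have "real s \<le> c2 * ln (real n)"
      using j by (simp add: s_def of_nat_diff)
    moreover have "?p + s = n"
      using j by (simp add: s_def)
    ultimately show ?thesis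
      using lower by blast
  qed
  moreover have "c2 > 0"
    by (auto simp: c2_def K_def D_def intro!: add_pos_pos)
  ultimately show ?thesis
    by (intro exI[of _ "1 / 3"] exI[of _ c2]) auto
qed

end
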